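(* Let $R$ be a commutative ring with $1\ne0$, $n\ge2$, $0<k<2^n-1$, and $\mathbf i=\mathbf i(k)$. Let $s$ be an $n$-dimensional sequence over $R$ indexed by $-\mathbb{N}^n$ and let $f\in R[X_1,\dots,X_n]$ with $\delta f\ge\mathbf 1$. Then the $k$-th border Laurent series $\beta_k(f,s)$ of $f$ and $s$ is $$\beta_k(f,s)=X_{\mathbf i'}\sum_{\mathbf 0\le a\le\delta}\ \sum_{\mathbf 0'\le a'\le\delta'-\mathbf 1'}\big(\nu^{a'+\mathbf 1'}f^{(a)}\big)(X_{\mathbf i'})\cdot\Gamma\big(X_{\mathbf i}^a\circ s^{(-a')}\big)(X_{\mathbf i}^{-1}),$$ where $\mathbf i'=\{1,\dots,n\}\setminus\mathbf i$, and $\delta,\delta'$ are the restrictions of $\delta f$ to the index sets $\mathbf i,\mathbf i'$.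
   Context: $\mathbb{N}=\{0,1,2,\dots\}$; $\mathbf 0=(0,\dots,0)$, $\mathbf 1=(1,\dots,1)$; vectors are ordered componentwise; $X^a=X_1^{a_1}\cdots X_n^{a_n}$. $P_n=R[X_1,\dots,X_n]$; $L_n=R((X_1^{-1},\dots,X_n^{-1}))$ is the ring of formal sums $G=\sum_{a\in\mathbb{Z}^n}G_aX^a$ whose support lies in $\{a:a\le d\}$ for some $d\in\mathbb{Z}^n$. For $G\in L_n$ and $A\subseteq\mathbb{Z}^n$, $G|A=\sum_{a\in A}G_aX^a$. For $f\in P_n$, $\delta f$ is the vector of partial degrees. A sequence is $s:-\mathbb{N}^n\to R$; $P_n$ acts by $(f\circ s)_b=\sum_af_as_{b-a}$ $(b\le\mathbf 0)$; $\Gamma(s)=\sum_{a\le\mathbf 0}s_aX^a\in R[[X_1^{-1},\dots,X_n^{-1}]]$. The same notions are used for variables and sequences indexed by any non-empty finite index set. For $0\le k\le2^n-1$ write $k=\sum_{i=1}^nb_i(k)2^{i-1}$ with $b_i(k)\in\{0,1\}$, and put $\mathbf i(k)=\{i:b_i(k)=1\}$. For $\delta f\ge\mathbf 1$, $\beta_k=\beta_k(-\infty,\delta f]=\prod_{i=1}^nI_i\subseteq\mathbb{Z}^n$, where $I_i=(-\infty,0]$ if $b_i(k)=1$ and $I_i=[1,\delta_if]$ if $b_i(k)=0$ (with $\delta_if$ the degree of $f$ in $X_i$). Define $\beta_k(f,s)=(f\cdot\Gamma(s))|\beta_k\in L_n$. For a polynomial $g$ and $a\ge\mathbf 0$, $\nu^ag=\sum_{a\le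 b\le\delta g}g_bX^{b-a}$ (empty sum $0$). For the proper non-empty subset $\mathbf i$ with complement $\mathbf i'$, $X_{\mathbf i}$, $X_{\mathbf i'}$ are the corresponding groups of variables (for $a\in\mathbb{Z}^{\mathbf i}$, $X_{\mathbf i}^a=\prod_{i\in\mathbf i}X_i^{a_i}$; the factor $X_{\mathbf i'}$ in front of the sum means $\prod_{i\in\mathbf i'}X_i$); for $a\in\mathbb{Z}^{\mathbf i},a'\in\mathbb{Z}^{\mathbf i'}$, $(a,a')\in\mathbb{Z}^n$ is the combined vector; $\mathbf 0',\mathbf 1'$ are the zero and all-ones vectors in $\mathbb{Z}^{\mathbf i'}$. For $\mathbf 0\le a\le\delta$, $f^{(a)}=\sum_{\mathbf 0'\le a'\le\delta'}f_{(a,a')}X_{\mathbf i'}^{a'}\in R[X_{\mathbf i'}]$. For $a'\in\mathbb{N}^{\mathbf i'}$, $s^{(-a')}:-\mathbb{N}^{\mathbf i}\to R$ is given by $s^{(-a')}_a=s_{(a,-a')}$. $\Gamma(X_{\mathbf i}^a\circ s^{(-a')})(X_{\mathbf i}^{-1})$ denotes the generating function, a power series in the inverses of the variables $X_{\mathbf i}$. *)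

theory Defs
  imports Main "HOL-Library.Function_Algebras"
begin

text \<open>
  Variables are indexed by natural numbers, and an exponent vector is a function
  \<open>nat \<Rightarrow> int\<close>.  For a finite index set \<open>I\<close>, the group of vectors indexed by \<open>I\<close> is identified
  with the functions that vanish outside \<open>I\<close>.  Under this identification the combined vector
  \<open>(a, a')\<close> of vectors over disjoint index sets is \<open>a + a'\<close>, and formal sums in different groups
  of variables live in one common type.  Arithmetic and order of exponents are pointwise; in
  particular \<open>{a..b}\<close> is a box, and it consists of vectors over \<open>I\<close> as soon as \<open>a\<close> and \<open>b\<close> do.
\<close>

type_synonym expo = "nat \<Rightarrow> int"

type_synonym 'a series = "expo \<Rightarrow> 'a"

definition expos :: "nat set \<Rightarrow> expo set" where
  "expos I = {a. \<forall>i. i \<notin> I \<longrightarrow> a i = 0}"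

definition restr :: "nat set \<Rightarrow> expo \<Rightarrow> expo" where
  "restr I a = (\<lambda>i. if i \<in> I then a i else 0)"

abbreviation ones :: "nat set \<Rightarrow> expo" where
  "ones I \<equiv> restr I 1"

definition supp :: "'a::zero series \<Rightarrow> expo set" where
  "supp G = {a. G a \<noteq> 0}"

definition laurent :: "nat set \<Rightarrow> 'a::zero series set" where
  "laurent I = {G. supp G \<subseteq> expos I \<and> (\<exists>d\<in>expos I. \<forall>a\<in>supp G. a \<le> d)}"

definition polys :: "nat set \<Rightarrow> 'a::zero series set" where
  "polys I = {f. finite (supp f) \<and> supp f \<subseteq> expos I \<and> (\<forall>a\<in>supp f. 0 \<le> a)}"

text \<open>
  The product of Laurent series.  Addition of series is pointwise addition of functions, but
  \<open>*\<close> on functions is the pointwise product and is not the one used here.  The sum defining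
  each coefficient is finite for Laurent series over a finite index set, see
  \<open>finite_conv\<close> below.
\<close>

definition conv :: "'a::comm_ring_1 series \<Rightarrow> 'a series \<Rightarrow> 'a series" (infixl "\<star>" 70) where
  "F \<star> G = (\<lambda>c. \<Sum>a\<in>{a. a \<in> supp F \<and> c - a \<in> supp G}. F a * G (c - a))"

definition monom :: "'a::zero \<Rightarrow> expo \<Rightarrow> 'a series" where
  "monom c a = (\<lambda>b. if b = a then c else 0)"

abbreviation xpow :: "expo \<Rightarrow> 'a::comm_ring_1 series" where
  "xpow a \<equiv> monom 1 a"

definition part :: "'a::zero series \<Rightarrow> expo set \<Rightarrow> 'a series" where
  "part G A = (\<lambda>a. if a \<in> A then G a else 0)"

text \<open>
  Partial degrees of a polynomial.  The inserted \<open>0\<close> only matters for the zero polynomial, and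
  gives degree \<open>0\<close> in the variables that do not occur.
\<close>

definition pdeg :: "'a::zero series \<Rightarrow> expo" where
  "pdeg f = (\<lambda>i. Max (insert 0 ((\<lambda>a. a i) ` supp f)))"

text \<open>
  A sequence indexed by the non-positive vectors over \<open>I\<close> is given by a total function on
  exponents.  Its values elsewhere are irrelevant: a polynomial over \<open>I\<close> acts on the values at
  non-positive vectors through such values only, and \<open>gen\<close> discards the other ones.
\<close>

definition act :: "'a::comm_ring_1 series \<Rightarrow> (expo \<Rightarrow> 'a) \<Rightarrow> (expo \<Rightarrow> 'a)" where
  "act f s = (\<lambda>b. \<Sum>a\<in>supp f. f a * s (b - a))"

definition gen :: "nat set \<Rightarrow> (expo \<Rightarrow> 'a::zero) \<Rightarrow> 'a series" where
  "gen I s = (\<lambda>a. if a \<in> expos I \<and> a \<le> 0 then s a else 0)"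

definition bits :: "nat \<Rightarrow> nat \<Rightarrow> nat set" where
  "bits n k = {i\<in>{1..n}. bit k (i - 1)}"

definition border_box :: "nat \<Rightarrow> nat \<Rightarrow> expo \<Rightarrow> expo set" where
  "border_box n k d = {a\<in>expos {1..n}. \<forall>i\<in>{1..n}.
     if i \<in> bits n k then a i \<in> {..0} else a i \<in> {1..d i}}"

definition border :: "nat \<Rightarrow> nat \<Rightarrow> 'a::comm_ring_1 series \<Rightarrow> (expo \<Rightarrow> 'a) \<Rightarrow> 'a series" where
  "border n k f s = part (f \<star> gen {1..n} s) (border_box n k (pdeg f))"

definition nu :: "expo \<Rightarrow> 'a::comm_ring_1 series \<Rightarrow> 'a series" where
  "nu a g = (\<Sum>b\<in>{a..pdeg g}. monom (g b) (b - a))"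

text \<open>
  \<open>coeff_poly I' f a\<close> is the polynomial $f^{(a)}$ in the variables of the index set \<open>I'\<close>,
  for an exponent \<open>a\<close> over the complementary index set; likewise
  \<open>slice s a'\<close> is the sequence $s^{(-a')}$.
\<close>

definition coeff_poly :: "nat set \<Rightarrow> 'a::comm_ring_1 series \<Rightarrow> expo \<Rightarrow> 'a series" where
  "coeff_poly I' f a = (\<Sum>a'\<in>{0..restr I' (pdeg f)}. monom (f (a + a')) a')"

definition slice :: "(expo \<Rightarrow> 'a) \<Rightarrow> expo \<Rightarrow> (expo \<Rightarrow> 'a)" where
  "slice s a' = (\<lambda>a. s (a + (- a')))"

lemma finite_box:
  assumes "finite I" "u \<in> expos I" "v \<in> expos I"
  shows "finite {u..v}"
proof (rule finite_subset)
  let ?B = "\<Union>i\<in>I. {u i..v i}"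
  show "{u..v} \<subseteq> {a. \<forall>i. (i \<in> I \<longrightarrow> a i \<in> ?B) \<and> (i \<notin> I \<longrightarrow> a i = 0)}"
  proof (intro subsetI CollectI allI conjI impI)
    fix a i assume a: "a \<in> {u..v}"
    then have le: "u i \<le> a i" "a i \<le> v i" by (simp_all add: le_fun_def)
    show "a i \<in> ?B" if "i \<in> I" using le that by auto
    show "a i = 0" if "i \<notin> I" using le that assms(2,3) by (simp add: expos_def)
  qed
  show "finite {a::expo. \<forall>i. (i \<in> I \<longrightarrow> a i \<in> ?B) \<and> (i \<notin> I \<longrightarrow> a i = 0)}"
    by (rule finite_set_of_finite_funs) (use assms(1) in auto)
qed

lemma finite_conv:
  assumes "finite I" "F \<in> laurent I" "G \<in> laurent I"
  shows "finite {a. a \<in> supp F \<and> c - a \<in> supp G}"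
proof -
  obtain d where d: "d \<in> expos I" "\<forall>a\<in>supp F. a \<le> d"
    using assms(2) by (auto simp: laurent_def)
  obtain e where e: "e \<in> expos I" "\<forall>a\<in>supp G. a \<le> e"
    using assms(3) by (auto simp: laurent_def)
  have "{a. a \<in> supp F \<and> c - a \<in> supp G} \<subseteq> {restr I (c - e)..d}"
  proof
    fix a assume "a \<in> {a. a \<in> supp F \<and> c - a \<in> supp G}"
    then have a: "a \<in> supp F" "c - a \<in> supp G" by auto
    have "a \<in> expos I" using a assms(2) by (auto simp: laurent_def)
    moreover have "c - a \<le> e" "a \<le> d" using a d e by auto
    then have "c i - a i \<le> e i" "a i \<le> d i" for i by (simp_all add: le_fun_def)
    then have "c i - e i \<le> a i" "a i \<le> d i" for i by (simp_all add: diff_le_eq add.commute)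
    ultimately show "a \<in> {restr I (c - e)..d}"
      by (simp add: restr_def expos_def le_fun_def)
  qed
  moreover have "finite {restr I (c - e)..d}"
    by (rule finite_box[OF assms(1)]) (use d in \<open>auto simp: expos_def restr_def\<close>)
  ultimately show ?thesis by (rule finite_subset)
qed

lemma conv_laurent:
  assumes "F \<in> laurent I" "G \<in> laurent I"
  shows "F \<star> G \<in> laurent I"
proof -
  obtain d where d: "d \<in> expos I" "\<forall>a\<in>supp F. a \<le> d"
    using assms(1) by (auto simp: laurent_def)
  obtain e where e: "e \<in> expos I" "\<forall>a\<in>supp G. a \<le> e"
    using assms(2) by (auto simp: laurent_def)
  have *: "c \<in> expos I \<and> c \<le> d + e" if c: "c \<in> supp (F \<star> G)" for c
  proof -
    have "\<exists>a. a \<in> supp F \<and> c - a \<in> supp G"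
    proof (rule ccontr)
      assume "\<not> ?thesis"
      then have "{a. a \<in> supp F \<and> c - a \<in> supp G} = {}" by blast
      then have "(F \<star> G) c = 0" by (simp only: conv_def sum.empty)
      then show False using c by (simp add: supp_def)
    qed
    then obtain a where a: "a \<in> supp F" "c - a \<in> supp G" by blast
    then have "a \<in> expos I" "c - a \<in> expos I" using assms by (auto simp: laurent_def)
    then have "c \<in> expos I" by (auto simp: expos_def)
    moreover have "a \<le> d" "c - a \<le> e" using a d e by auto
    then have le: "a i \<le> d i" "c i - a i \<le> e i" for i by (auto simp: le_fun_def)
    have "c i \<le> d i + e i" for i using le[of i] by linarith
    then have "c \<le> d + e" by (simp add: le_fun_def)
    ultimately show ?thesis by blast
  qed
  have "d + e \<in> expos I" using d e by (auto simp: expos_def)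
  then show ?thesis using * by (auto simp: laurent_def)
qed

lemma polys_laurent:
  assumes "f \<in> polys I"
  shows "f \<in> laurent I"
proof -
  have "a \<le> pdeg f" if "a \<in> supp f" for a
    using that assms by (auto simp: le_fun_def pdeg_def polys_def intro!: Max_ge)
  moreover have "pdeg f i = 0" if "i \<notin> I" for i
  proof -
    have "insert 0 ((\<lambda>a. a i) ` supp f) = {0}"
      using that assms by (auto simp: polys_def expos_def)
    then show ?thesis by (simp only: pdeg_def Max_singleton)
  qed
  ultimately show ?thesis using assms by (auto simp: laurent_def polys_def expos_def)
qed

lemma gen_laurent: "gen I s \<in> laurent I"
proof -
  have "supp (gen I s) \<subseteq> expos I" "\<forall>a\<in>supp (gen I s). a \<le> 0"
    by (auto simp: supp_def gen_def split: if_splits)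
  moreover have "0 \<in> expos I" by (simp add: expos_def)
  ultimately show ?thesis unfolding laurent_def by blast
qed

lemma border_laurent:
  assumes "f \<in> polys {1..n}"
  shows "border n k f s \<in> laurent {1..n}"
proof -
  have "f \<star> gen {1..n} s \<in> laurent {1..n}"
    by (intro conv_laurent polys_laurent gen_laurent assms)
  moreover have "supp (part G A) \<subseteq> supp G" for G :: "'a series" and A
    by (auto simp: part_def supp_def)
  ultimately show ?thesis
    unfolding border_def laurent_def by blast
qed

end

theory Submission
  imports Defs
begin

text \<open>
  Let \<open>J\<close> be the complement of \<open>I = bits n k\<close>, and fix an exponent \<open>c\<close>, with parts \<open>c\<^sub>I\<close> and \<open>c\<^sub>J\<close>
  over the two groups of variables.  Both sides of the identity have at \<open>c\<close> a coefficient that is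
  a sum of terms \<open>f e * s (c - e)\<close>, and the point is that the same exponents \<open>e\<close> contribute.

  On the left, \<open>e\<close> runs over the support of \<open>f\<close> subject to \<open>c - e \<le> 0\<close>.  Since
  \<open>c\<^sub>I \<le> 0 \<le> e\<^sub>I\<close> in the border box, this is a condition on the \<open>J\<close>-part only: \<open>c\<^sub>J \<le> e\<^sub>J\<close>.
  On the right, each summand is a product of a polynomial in the variables of \<open>J\<close> and a series in
  those of \<open>I\<close>, so that its coefficient is a single product of two coefficients
  (\<open>conv_disjoint\<close>); the summand for \<open>a\<close> and \<open>a'\<close> gives
  \<open>f (a + a' + c\<^sub>J) * s (c\<^sub>I - a - a')\<close> if \<open>c\<^sub>I \<le> 0\<close> and \<open>1 \<le> c\<^sub>J\<close>, and \<open>0\<close> otherwise.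
  This is the term of \<open>e = a + a' + c\<^sub>J\<close>, so \<open>a = e\<^sub>I\<close>, and \<open>a' = e\<^sub>J - c\<^sub>J\<close> is the slack in the
  condition \<open>c\<^sub>J \<le> e\<^sub>J\<close>.  As \<open>e\<^sub>J\<close> is at most
  the degree \<open>\<delta>'\<close> of \<open>f\<close> in the variables of \<open>J\<close> and \<open>1 \<le> c\<^sub>J\<close>, the slack is at most \<open>\<delta>' - 1\<close>, so the summation box
  on the right loses nothing (\<open>sum_boxes_eq_sum_supp\<close>).  Finally, if \<open>c\<^sub>J \<le> \<delta>'\<close> fails, then all
  the exponents \<open>a + a' + c\<^sub>J\<close> lie beyond the degree of \<open>f\<close>, in agreement with the restriction to
  the border box.
\<close>

section \<open>Exponents over two groups of variables\<close>

lemma restr_in_expos: "restr I a \<in> expos I"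
  by (simp add: restr_def expos_def)

lemma restr_of_expos: "a \<in> expos I \<Longrightarrow> restr I a = a"
  by (auto simp: restr_def expos_def)

lemma restr_of_disjoint_expos: "a \<in> expos J \<Longrightarrow> I \<inter> J = {} \<Longrightarrow> restr I a = 0"
  by (auto simp: restr_def expos_def fun_eq_iff)

lemma restr_add: "restr I (a + b) = restr I a + restr I b"
  by (auto simp: restr_def)

lemma restr_split:
  assumes "I \<inter> J = {}" "c \<in> expos (I \<union> J)"
  shows "restr I c + restr J c = c"
  using assms by (auto simp: restr_def expos_def fun_eq_iff)

lemma expos_add: "a \<in> expos I \<Longrightarrow> b \<in> expos I \<Longrightarrow> a + b \<in> expos I"
  by (simp add: expos_def)

lemma expos_diff: "a \<in> expos I \<Longrightarrow> b \<in> expos I \<Longrightarrow> a - b \<in> expos I"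
  by (simp add: expos_def)

lemma expos_mono: "a \<in> expos I \<Longrightarrow> I \<subseteq> K \<Longrightarrow> a \<in> expos K"
  by (auto simp: expos_def)

lemma box_subset_expos: "v \<in> expos I \<Longrightarrow> a \<in> {0..v} \<Longrightarrow> a \<in> expos I"
  unfolding expos_def le_fun_def atLeastAtMost_iff mem_Collect_eq zero_fun_def
  by (metis order_antisym)

lemma supp_le_pdeg:
  assumes "f \<in> polys K" "f a \<noteq> 0"
  shows "a \<le> pdeg f"
  using assms by (auto simp: le_fun_def pdeg_def polys_def supp_def intro!: Max_ge)

lemma pdeg_in_expos:
  assumes "f \<in> polys K"
  shows "pdeg f \<in> expos K"
  unfolding expos_def
proof (intro CollectI allI impI)
  fix i assume "i \<notin> K"
  then have "insert 0 ((\<lambda>a. a i) ` supp f) = {0}"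
    using assms by (auto simp: polys_def expos_def)
  then show "pdeg f i = 0" by (simp only: pdeg_def Max_singleton)
qed

section \<open>Coefficients of the series involved\<close>

lemma sum_fun_apply: "(\<Sum>x\<in>A. F x) c = (\<Sum>x\<in>A. F x c)"
  by (induction A rule: infinite_finite_induct) auto

lemma supp_xpow: "supp (xpow u :: 'a::comm_ring_1 series) = {u}"
  by (auto simp: supp_def monom_def)

lemma conv_xpow:
  fixes G :: "'a::comm_ring_1 series"
  shows "(xpow u \<star> G) c = G (c - u)"
proof -
  have "{a. a \<in> supp (xpow u :: 'a series) \<and> c - a \<in> supp G} =
      (if G (c - u) = 0 then {} else {u})"
    unfolding supp_xpow by (auto simp: supp_def)
  then show ?thesis unfolding conv_def by (simp add: monom_def)
qed

lemma act_xpow: "act (xpow a) s = (\<lambda>b. s (b - a))"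
  unfolding act_def supp_xpow by (simp add: monom_def)

text \<open>
  An exponent over \<open>I \<union> J\<close> splits in only one way into parts over \<open>I\<close> and over \<open>J\<close>, so the
  Cauchy product of series in separate groups of variables has one term per coefficient.
\<close>

lemma conv_disjoint:
  fixes F G :: "'a::comm_ring_1 series"
  assumes disj: "I \<inter> J = {}" and F: "supp F \<subseteq> expos J" and G: "supp G \<subseteq> expos I"
  shows "(F \<star> G) c = (if c \<in> expos (I \<union> J) then F (restr J c) * G (restr I c) else 0)"
proof -
  let ?A = "{a. a \<in> supp F \<and> c - a \<in> supp G}"
  have split: "c \<in> expos (I \<union> J) \<and> a = restr J c" if "a \<in> ?A" for a
  proof -
    have a: "a \<in> expos J" "c - a \<in> expos I" using that F G by auto
    then have "a + (c - a) \<in> expos (I \<union> J)"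
      by (intro expos_add) (auto intro: expos_mono)
    moreover have "restr J (a + (c - a)) = restr J a + restr J (c - a)" by (rule restr_add)
    ultimately show ?thesis
      using a disj by (simp add: restr_of_expos restr_of_disjoint_expos Int_commute)
  qed
  show ?thesis
  proof (cases "c \<in> expos (I \<union> J)")
    case True
    then have "c - restr J c = restr I c"
      using restr_split[OF disj True] by (metis add_diff_cancel_right')
    moreover have "(F \<star> G) c = (\<Sum>a\<in>{restr J c}. F a * G (c - a))"
      unfolding conv_def supp_def mem_Collect_eq
    proof (rule sum.mono_neutral_left)
      show "{a. F a \<noteq> 0 \<and> G (c - a) \<noteq> 0} \<subseteq> {restr J c}"
        using split unfolding supp_def by blast
      show "\<forall>a\<in>{restr J c} - {a. F a \<noteq> 0 \<and> G (c - a) \<noteq> 0}. F a * G (c - a) = 0"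
        by (metis (mono_tags, lifting) DiffD2 mem_Collect_eq mult_zero_left mult_zero_right)
    qed simp
    ultimately show ?thesis using True by simp
  next
    case False
    then have "?A = {}" using split by blast
    then show ?thesis using False by (simp only: conv_def sum.empty if_False)
  qed
qed

text \<open>
  Beyond \<open>pdeg g\<close> the coefficients of \<open>g\<close> vanish, so \<open>nu a g\<close> is \<open>g\<close> shifted down by \<open>a\<close>, without
  the terms that acquire a negative exponent.
\<close>

lemma nu_apply:
  assumes "finite J" "g \<in> polys J" "a \<in> expos J"
  shows "nu a g c = (if 0 \<le> c then g (a + c) else 0)"
proof -
  have fin: "finite {a..pdeg g}"
    by (rule finite_box[OF assms(1,3) pdeg_in_expos[OF assms(2)]])
  have "nu a g c = (\<Sum>b\<in>{a..pdeg g}. if b = a + c then g b else 0)"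
    unfolding nu_def sum_fun_apply monom_def
    by (rule sum.cong) (auto simp: algebra_simps)
  also have "\<dots> = (if a + c \<in> {a..pdeg g} then g (a + c) else 0)"
    using fin by simp
  also have "\<dots> = (if 0 \<le> c then g (a + c) else 0)"
    using supp_le_pdeg[OF assms(2), of "a + c"] by (auto simp: le_fun_def)
  finally show ?thesis .
qed

lemma coeff_poly_apply:
  assumes "finite J" "f \<in> polys K" "I \<inter> J = {}" "a \<in> expos I"
  shows "coeff_poly J f a c = (if c \<in> expos J then f (a + c) else 0)"
proof -
  let ?d = "restr J (pdeg f)"
  have "finite {0..?d}"
    by (rule finite_box[OF assms(1)]) (simp_all add: restr_in_expos, simp add: expos_def)
  moreover have "coeff_poly J f a c = (\<Sum>b\<in>{0..?d}. if b = c then f (a + b) else 0)"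
    unfolding coeff_poly_def sum_fun_apply monom_def by (rule sum.cong) auto
  ultimately have eq: "coeff_poly J f a c = (if c \<in> {0..?d} then f (a + c) else 0)"
    by simp
  have "f (a + c) = 0" if c: "c \<in> expos J" "c \<notin> {0..?d}"
  proof (rule ccontr)
    assume nz: "f (a + c) \<noteq> 0"
    have "0 \<le> a + c" using nz assms(2) by (auto simp: polys_def supp_def)
    moreover have "a + c \<le> pdeg f" using supp_le_pdeg[OF assms(2) nz] .
    ultimately have le: "0 \<le> a i + c i" "a i + c i \<le> pdeg f i" for i
      by (simp_all add: le_fun_def)
    have "0 \<le> c i \<and> c i \<le> ?d i" for i
    proof (cases "i \<in> J")
      case True
      then have "a i = 0" using assms(3,4) by (auto simp: expos_def)
      then show ?thesis using le[of i] True by (simp add: restr_def)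
    next
      case False
      then show ?thesis using c(1) by (simp add: expos_def restr_def)
    qed
    then show False using c(2) by (simp add: le_fun_def)
  qed
  then show ?thesis
    unfolding eq using box_subset_expos[OF restr_in_expos] by auto
qed

lemma coeff_poly_in_polys:
  assumes "finite J" "f \<in> polys K" "I \<inter> J = {}" "a \<in> expos I"
  shows "coeff_poly J f a \<in> polys J"
proof -
  have eq: "coeff_poly J f a c = (if c \<in> expos J then f (a + c) else 0)" for c
    by (rule coeff_poly_apply[OF assms])
  have sub: "supp (coeff_poly J f a) \<subseteq> (\<lambda>e. e - a) ` supp f"
  proof
    fix c assume "c \<in> supp (coeff_poly J f a)"
    then have "a + c \<in> supp f" by (auto simp: supp_def eq split: if_splits)
    then show "c \<in> (\<lambda>e. e - a) ` supp f" by (rule rev_image_eqI) simp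
  qed
  have "0 \<le> c" if "c \<in> supp (coeff_poly J f a)" for c
  proof -
    have c: "c \<in> expos J" "a + c \<in> supp f"
      using that by (auto simp: supp_def eq split: if_splits)
    have le: "0 \<le> a i + c i" for i using c(2) assms(2) by (auto simp: polys_def le_fun_def)
    have "0 \<le> c i" for i
      using le[of i] c(1) assms(3,4) by (cases "i \<in> J") (auto simp: expos_def)
    then show ?thesis by (simp add: le_fun_def)
  qed
  moreover have "finite (supp (coeff_poly J f a))"
    using sub assms(2) by (auto simp: polys_def intro: finite_subset)
  ultimately show ?thesis
    by (auto simp: polys_def supp_def eq split: if_splits)
qed

lemma conv_gen:
  fixes f :: "'a::comm_ring_1 series"
  assumes "f \<in> polys K" "c \<in> expos K"
  shows "(f \<star> gen K s) c = (\<Sum>e\<in>{e\<in>supp f. c \<le> e}. f e * s (c - e))"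
proof -
  have fin: "finite (supp f)" and sub: "supp f \<subseteq> expos K"
    using assms by (auto simp: polys_def)
  have val: "gen K s (c - e) = (if c \<le> e then s (c - e) else 0)" if "e \<in> supp f" for e
    using expos_diff[OF assms(2)] sub that by (auto simp: gen_def le_fun_def)
  have "(f \<star> gen K s) c = (\<Sum>e\<in>supp f. f e * gen K s (c - e))"
    unfolding conv_def
    by (rule sum.mono_neutral_left) (use fin in \<open>auto simp: supp_def\<close>)
  also have "\<dots> = (\<Sum>e\<in>supp f. if c \<le> e then f e * s (c - e) else 0)"
    by (rule sum.cong) (auto simp: val)
  finally show ?thesis using fin by (simp add: sum.inter_filter)
qed

section \<open>Comparison of the two coefficients\<close>

text \<open>
  This is the substitution \<open>e = a + a' + c\<^sub>J\<close>, with inverse \<open>a = e\<^sub>I\<close>, \<open>a' = e\<^sub>J - c\<^sub>J\<close>.  Pairs whose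
  image is outside the support of \<open>f\<close> contribute \<open>0\<close>.
\<close>

lemma sum_boxes_eq_sum_supp:
  fixes f :: "'a::comm_ring_1 series"
  assumes fin: "finite I" "finite J" and disj: "I \<inter> J = {}" and f: "f \<in> polys (I \<union> J)"
    and c: "c \<in> expos (I \<union> J)" "\<And>i. i \<in> I \<Longrightarrow> c i \<le> 0" "\<And>i. i \<in> J \<Longrightarrow> 1 \<le> c i"
  shows "(\<Sum>a\<in>{0..restr I (pdeg f)}. \<Sum>a'\<in>{0..restr J (pdeg f) - ones J}.
            f (a + (a' + restr J c)) * s (restr I c - a - a')) =
         (\<Sum>e\<in>{e\<in>supp f. c \<le> e}. f e * s (c - e))"
    (is "?lhs = ?rhs")
proof -
  let ?A = "{0..restr I (pdeg f)}" and ?B = "{0..restr J (pdeg f) - ones J}"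
  let ?\<phi> = "\<lambda>(a, a'). a + (a' + restr J c)"
  let ?\<psi> = "\<lambda>e. (restr I e, restr J e - restr J c)"
  have 0: "0 \<in> expos L" for L by (simp add: expos_def)
  have finA: "finite ?A" by (rule finite_box[OF fin(1) 0 restr_in_expos])
  have finB: "finite ?B"
    by (rule finite_box[OF fin(2) 0]) (intro expos_diff restr_in_expos)
  have in_expos: "a \<in> expos I" "a' \<in> expos J" if "a \<in> ?A" "a' \<in> ?B" for a a'
    using that box_subset_expos[OF restr_in_expos]
      box_subset_expos[OF expos_diff[OF restr_in_expos restr_in_expos]] by blast+
  have finS: "finite (supp f)" using f by (simp add: polys_def)
  have "?lhs = (\<Sum>(a, a')\<in>?A \<times> ?B. f (a + (a' + restr J c)) * s (restr I c - a - a'))"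
    by (rule sum.cartesian_product)
  also have "\<dots> = ?rhs"
  proof (rule sum.reindex_bij_witness_not_neutral
      [where S' = "{p \<in> ?A \<times> ?B. f (?\<phi> p) = 0}" and T' = "{}" and j = ?\<phi> and i = ?\<psi>])
    show "finite {p \<in> ?A \<times> ?B. f (?\<phi> p) = 0}"
      using finA finB by (intro finite_subset[OF _ finite_cartesian_product[of ?A ?B]]) auto
  next
    fix p assume "p \<in> ?A \<times> ?B - {p \<in> ?A \<times> ?B. f (?\<phi> p) = 0}"
    then obtain a a' where p: "p = (a, a')" "a \<in> ?A" "a' \<in> ?B"
        "f (a + (a' + restr J c)) \<noteq> 0" by auto
    have x: "a \<in> expos I" "a' \<in> expos J" using in_expos p by auto
    show "?\<psi> (?\<phi> p) = p"
      using restr_of_expos[OF x(1)] restr_of_expos[OF x(2)]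
        restr_of_disjoint_expos[OF x(1), of J] restr_of_disjoint_expos[OF x(2) disj]
        restr_of_disjoint_expos[OF restr_in_expos disj, of c]
        restr_of_expos[OF restr_in_expos, of J c] disj
      by (simp add: p(1) restr_add Int_commute)
    have "c i \<le> (a + (a' + restr J c)) i" for i
    proof -
      have "0 \<le> a i" "0 \<le> a' i" using p by (auto simp: le_fun_def)
      moreover have "i \<notin> J \<Longrightarrow> c i \<le> 0"
        using c(1) c(2)[of i] by (cases "i \<in> I") (auto simp: expos_def)
      ultimately show ?thesis by (cases "i \<in> J") (simp_all add: restr_def)
    qed
    then have "c \<le> ?\<phi> p" by (simp add: p(1) le_fun_def)
    then show "?\<phi> p \<in> {e\<in>supp f. c \<le> e} - {}"
      using p by (simp add: supp_def)
  next
    fix e assume "e \<in> {e\<in>supp f. c \<le> e} - {}"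
    then have e: "f e \<noteq> 0" "c \<le> e" by (auto simp: supp_def)
    then have ex: "e \<in> expos (I \<union> J)" "0 \<le> e" using f by (auto simp: polys_def supp_def)
    show inv: "?\<phi> (?\<psi> e) = e" using restr_split[OF disj ex(1)] by simp
    have pd: "e \<le> pdeg f" by (rule supp_le_pdeg[OF f e(1)])
    have "restr I e \<in> ?A" using ex pd by (simp add: le_fun_def restr_def)
    moreover have "0 \<le> (restr J e - restr J c) i \<and>
        (restr J e - restr J c) i \<le> (restr J (pdeg f) - ones J) i" for i
    proof (cases "i \<in> J")
      case True
      have "c i \<le> e i" "e i \<le> pdeg f i" using e(2) pd by (simp_all add: le_fun_def)
      then show ?thesis using c(3)[OF True] True by (simp add: restr_def)
    qed (simp add: restr_def)
    then have "restr J e - restr J c \<in> ?B" by (simp add: le_fun_def)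
    ultimately show "?\<psi> e \<in> ?A \<times> ?B - {p \<in> ?A \<times> ?B. f (?\<phi> p) = 0}"
      using e(1) inv by simp
  next
    fix p assume "p \<in> ?A \<times> ?B"
    then obtain a a' where p: "p = (a, a')" by (cases p)
    have "c - (a + (a' + restr J c)) = restr I c - a - a'"
      using restr_split[OF disj c(1)] by (auto simp: fun_eq_iff algebra_simps)
    then show "f (?\<phi> p) * s (c - ?\<phi> p) =
        (case p of (a, a') \<Rightarrow> f (a + (a' + restr J c)) * s (restr I c - a - a'))"
      by (simp only: p prod.case)
  qed (use finS in auto)
  finally show ?thesis .
qed

text \<open>
  The shift by \<open>ones J\<close> in \<open>nu\<close> is undone by the factor \<open>xpow (ones J)\<close>, which is why \<open>f\<close> is
  evaluated at \<open>a + (a' + restr J c)\<close>; its only trace is the condition \<open>1 \<le> c i\<close> for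
  \<open>i \<in> J\<close>.
\<close>

lemma border_summand:
  fixes f :: "'a::comm_ring_1 series"
  assumes J: "finite J" and disj: "I \<inter> J = {}" and f: "f \<in> polys (I \<union> J)"
    and a: "a \<in> expos I" "a' \<in> expos J"
  shows "(nu (a' + ones J) (coeff_poly J f a) \<star> gen I (act (xpow a) (slice s a'))) (c - ones J) =
    (if c \<in> expos (I \<union> J) \<and> (\<forall>i\<in>I. c i \<le> 0) \<and> (\<forall>i\<in>J. 1 \<le> c i)
     then f (a + (a' + restr J c)) * s (restr I c - a - a') else 0)"
proof -
  let ?N = "nu (a' + ones J) (coeff_poly J f a)"
    and ?G = "gen I (act (xpow a) (slice s a'))"
  have shift: "a' + ones J \<in> expos J" by (intro expos_add a restr_in_expos)
  have N: "?N x = (if 0 \<le> x \<and> x \<in> expos J then f (a + (a' + ones J + x)) else 0)" for x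
  proof -
    have "a' + ones J + x \<in> expos J \<longleftrightarrow> x \<in> expos J"
      using shift by (auto simp: expos_def)
    then show ?thesis
      by (simp add: nu_apply[OF J coeff_poly_in_polys[OF J f disj a(1)] shift]
          coeff_poly_apply[OF J f disj a(1)])
  qed
  have suppN: "supp ?N \<subseteq> expos J" by (auto simp: supp_def N split: if_splits)
  have suppG: "supp ?G \<subseteq> expos I" by (auto simp: supp_def gen_def split: if_splits)
  have ones: "ones J \<in> expos (I \<union> J)" by (rule expos_mono[OF restr_in_expos]) simp
  have ex: "c - ones J \<in> expos (I \<union> J) \<longleftrightarrow> c \<in> expos (I \<union> J)"
    using ones by (auto simp: expos_def)
  have rJ: "restr J (c - ones J) = restr J c - ones J" by (auto simp: restr_def)
  have rI: "restr I (c - ones J) = restr I c" using disj by (auto simp: restr_def fun_eq_iff)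
  have "0 \<le> restr J c - ones J \<longleftrightarrow> (\<forall>i\<in>J. 1 \<le> c i)" by (auto simp: restr_def le_fun_def)
  moreover have "a' + ones J + (restr J c - ones J) = a' + restr J c" by simp
  ultimately have NJ: "?N (restr J c - ones J) =
      (if \<forall>i\<in>J. 1 \<le> c i then f (a + (a' + restr J c)) else 0)"
    by (simp add: N expos_diff restr_in_expos)
  have "restr I c \<le> 0 \<longleftrightarrow> (\<forall>i\<in>I. c i \<le> 0)" by (auto simp: restr_def le_fun_def)
  then have GI: "?G (restr I c) = (if \<forall>i\<in>I. c i \<le> 0 then s (restr I c - a - a') else 0)"
    by (simp add: gen_def restr_in_expos act_xpow slice_def)
  show ?thesis
    by (simp add: conv_disjoint[OF disj suppN suppG] ex rJ rI NJ GI)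
qed

theorem theorem3p8:
  fixes n k :: nat
    and s :: "expo \<Rightarrow> 'a::comm_ring_1"
    and f :: "'a series"
  assumes "n \<ge> 2"
    and "0 < k" and "k < 2 ^ n - 1"
    and "f \<in> polys {1..n}"
    and "\<forall>i\<in>{1..n}. 1 \<le> pdeg f i"
  shows "let I = bits n k; I' = {1..n} - I; d = restr I (pdeg f); d' = restr I' (pdeg f) in
    border n k f s =
      xpow (ones I') \<star>
        (\<Sum>a\<in>{0..d}. \<Sum>a'\<in>{0..d' - ones I'}.
          nu (a' + ones I') (coeff_poly I' f a) \<star> gen I (act (xpow a) (slice s a')))"
proof -
  define I J where "I = bits n k" and "J = {1..n} - I"
  define A B where "A = {0..restr I (pdeg f)}" and "B = {0..restr J (pdeg f) - ones J}"
  have IJ: "I \<union> J = {1..n}" and disj: "I \<inter> J = {}" and J: "finite J" and I: "finite I"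
    by (auto simp: I_def J_def bits_def)
  have f: "f \<in> polys (I \<union> J)" using assms(4) by (simp add: IJ)
  have inAB: "a \<in> expos I" "a' \<in> expos J" if "a \<in> A" "a' \<in> B" for a a'
    using that box_subset_expos[OF restr_in_expos]
      box_subset_expos[OF expos_diff[OF restr_in_expos restr_in_expos]]
    unfolding A_def B_def by blast+
  have "border n k f s c = (xpow (ones J) \<star> (\<Sum>a\<in>A. \<Sum>a'\<in>B.
      nu (a' + ones J) (coeff_poly J f a) \<star> gen I (act (xpow a) (slice s a')))) c"
    (is "_ = ?R c") for c
  proof -
    define P where "P \<longleftrightarrow> c \<in> expos (I \<union> J) \<and> (\<forall>i\<in>I. c i \<le> 0) \<and> (\<forall>i\<in>J. 1 \<le> c i)"
    let ?S = "\<Sum>e\<in>{e\<in>supp f. c \<le> e}. f e * s (c - e)"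
    have "?R c = (\<Sum>a\<in>A. \<Sum>a'\<in>B.
        if P then f (a + (a' + restr J c)) * s (restr I c - a - a') else 0)"
      unfolding conv_xpow sum_fun_apply P_def
      by (intro sum.cong refl border_summand J disj f inAB)
    also have "\<dots> = (if P then ?S else 0)"
    proof (cases P)
      case True
      then show ?thesis
        using sum_boxes_eq_sum_supp[OF I J disj f, of c s] by (simp add: P_def A_def B_def)
    qed simp
    finally have R: "?R c = (if P then ?S else 0)" .
    have box: "c \<in> border_box n k (pdeg f) \<longleftrightarrow> P \<and> (\<forall>i\<in>J. c i \<le> pdeg f i)"
      unfolding border_box_def P_def IJ[symmetric] I_def[symmetric]
      using disj by auto
    (* Outside the degree bound no exponent of f dominates c, so the sum is empty. *)
    have "\<forall>i\<in>J. c i \<le> pdeg f i" if ne: "{e\<in>supp f. c \<le> e} \<noteq> {}"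
    proof -
      obtain e where "f e \<noteq> 0" "c \<le> e" using ne unfolding supp_def by blast
      then have "c \<le> pdeg f" using supp_le_pdeg[OF f] order_trans by blast
      then show ?thesis by (simp add: le_fun_def)
    qed
    then have "?S = 0" if "\<not> (\<forall>i\<in>J. c i \<le> pdeg f i)"
      using that by (intro sum.neutral) blast
    moreover have "(f \<star> gen {1..n} s) c = ?S" if P
      by (rule conv_gen[OF assms(4)]) (use that in \<open>simp add: P_def IJ\<close>)
    ultimately show ?thesis
      unfolding R border_def part_def box by auto
  qed
  then show ?thesis
    unfolding Let_def I_def[symmetric] J_def[symmetric] A_def[symmetric] B_def[symmetric]
    by (rule ext)
qed

end
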